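(* If $H$ is a real Hilbert space with $\dim H\ge2$, then $$J^B_{H,t}(\tau)=\sqrt{1+\tau^2}\qquad(\tau\ge0,\ -\infty\le t<\infty),$$ and therefore $C^B_t(H)=1$ for every $-\infty\le t<\infty$.
   Context: For a real Banach space $X$ with unit sphere $S_X$ and $x,y\in X$, Birkhoff-James orthogonality $x\perp_B y$ means $\|x+\lambda y\|\ge\|x\|$ for all $\lambda\in\mathbb{R}$. For $a,b>0$ set $M_t(a,b)=\left(\frac{a^t+b^t}{2}\right)^{1/t}$ if $t\in\mathbb{R}\setminus\{0\}$, $M_0(a,b)=\sqrt{ab}$, and $M_{-\infty}(a,b)=\min\{a,b\}$. For $-\infty\le t<\infty$ and $\tau\ge 0$ define $$J^B_{X,t}(\tau)=\sup\{M_t(\|x+\tau y\|,\|x-\tau y\|): x,y\in S_X,\ x\perp_B y\},\qquad C^B_t(X)=\sup_{0\le\tau\le1}\frac{J^B_{X,t}(\tau)^2}{1+\tau^2}.$$ *)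

theory Defs
  imports "HOL-Analysis.Analysis"
begin

definition birkhoff_orthogonal :: "'a::real_normed_vector \<Rightarrow> 'a \<Rightarrow> bool"
    (infix "\<bottom>\<^sub>B" 50)
  where "x \<bottom>\<^sub>B y \<longleftrightarrow> (\<forall>r::real. norm (x + r *\<^sub>R y) \<ge> norm x)"

text \<open>The power mean of order \<open>t\<close> of two positive reals. Only \<open>t < \<infinity>\<close> is used;
  the value at \<open>\<infinity>\<close> is the usual limit convention and merely makes the function total.\<close>

definition power_mean :: "ereal \<Rightarrow> real \<Rightarrow> real \<Rightarrow> real"
  where "power_mean t a b =
    (case t of
       ereal r \<Rightarrow> if r = 0 then sqrt (a * b) else ((a powr r + b powr r) / 2) powr (1 / r)
     | PInfty \<Rightarrow> max a b
     | MInfty \<Rightarrow> min a b)"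

text \<open>Real suprema are meaningful here: both arguments of the mean lie between \<open>1\<close> (by
  orthogonality) and \<open>1 + \<tau>\<close>, and the index set is nonempty once the space has dimension at
  least two.\<close>

definition J_B :: "'a::real_normed_vector itself \<Rightarrow> ereal \<Rightarrow> real \<Rightarrow> real"
  where "J_B _ t \<tau> =
    Sup {power_mean t (norm (x + \<tau> *\<^sub>R y)) (norm (x - \<tau> *\<^sub>R y)) | x y :: 'a.
           x \<in> sphere 0 1 \<and> y \<in> sphere 0 1 \<and> x \<bottom>\<^sub>B y}"

definition C_B :: "'a::real_normed_vector itself \<Rightarrow> ereal \<Rightarrow> real"
  where "C_B X t = (SUP \<tau>\<in>{0..1}. (J_B X t \<tau>)\<^sup>2 / (1 + \<tau>\<^sup>2))"

text \<open>The library's \<open>dim\<close> is \<open>nat\<close>-valued and returns \<open>0\<close> on infinite-dimensional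
  spaces, so a lower bound on the dimension is stated via the cardinality of a basis.\<close>

definition dim_at_least :: "'a::real_vector itself \<Rightarrow> nat \<Rightarrow> bool"
  where "dim_at_least _ n \<longleftrightarrow>
    (\<exists>B::'a set. independent B \<and> span B = UNIV \<and> (infinite B \<or> n \<le> card B))"

end

theory Submission
  imports Defs
begin

text \<open>In an inner product space Birkhoff-James orthogonality is ordinary orthogonality. By
  Pythagoras, for every admissible pair both x + \<tau>y and x - \<tau>y have norm sqrt (1 +
  \<tau>^2), and a power mean of two equal positive numbers is that number, whatever its order. So
  the supremum in \<open>J_B\<close> runs over at most one value; dimension at least two supplies an
  orthonormal pair, so that value is attained. The quotient in \<open>C_B\<close> is then constantly
  1.\<close>

lemma birkhoff_orthogonal_iff_orthogonal:
  fixes x y :: "'a::real_inner"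
  shows "x \<bottom>\<^sub>B y \<longleftrightarrow> orthogonal x y"
proof
  assume "orthogonal x y"
  then have "(norm x)\<^sup>2 \<le> (norm (x + r *\<^sub>R y))\<^sup>2" for r
    by (simp add: norm_add_Pythagorean orthogonal_clauses)
  then show "x \<bottom>\<^sub>B y"
    unfolding birkhoff_orthogonal_def using norm_ge_zero power2_le_imp_le by blast
next
  assume xy: "x \<bottom>\<^sub>B y"
  show "orthogonal x y"
  proof (cases "y = 0")
    case True
    then show ?thesis
      by (simp add: orthogonal_def)
  next
    case False
    \<comment> \<open>This \<open>r\<close> minimizes the norm of x + r y: it removes from x its
      projection onto y. The squared norm drops by (x \<bullet> y)^2 / (y \<bullet> y), which the
      hypothesis forbids unless x \<bullet> y = 0.\<close>
    define r where "r = - (x \<bullet> y) / (y \<bullet> y)"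
    have "norm x \<le> norm (x + r *\<^sub>R y)"
      using xy by (simp add: birkhoff_orthogonal_def)
    then have "x \<bullet> x \<le> (x + r *\<^sub>R y) \<bullet> (x + r *\<^sub>R y)"
      by (simp add: norm_le)
    also have "\<dots> = x \<bullet> x - (x \<bullet> y)\<^sup>2 / (y \<bullet> y)"
      using False by (simp add: r_def inner_simps inner_commute field_simps power2_eq_square)
    finally have "(x \<bullet> y)\<^sup>2 / (y \<bullet> y) \<le> 0"
      by simp
    then have "(x \<bullet> y)\<^sup>2 \<le> 0"
      using False by (simp add: divide_le_0_iff flip: inner_gt_zero_iff)
    then show ?thesis
      by (simp add: orthogonal_def)
  qed
qed

lemma power_mean_same:
  assumes "a > 0"
  shows "power_mean t a a = a"
  using assms by (cases t) (auto simp: power_mean_def powr_powr)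

lemma norm_add_orthonormal:
  fixes x y :: "'a::real_inner"
  assumes "orthogonal x y" "norm x = 1" "norm y = 1"
  shows "norm (x + c *\<^sub>R y) = sqrt (1 + c\<^sup>2)"
proof -
  have "(norm (x + c *\<^sub>R y))\<^sup>2 = 1 + c\<^sup>2"
    using assms by (simp add: norm_add_Pythagorean orthogonal_clauses)
  then show ?thesis
    by (metis norm_ge_zero real_sqrt_unique)
qed

text \<open>Gram-Schmidt applied to two distinct elements of a basis.\<close>

lemma dim_at_least_2_imp_orthonormal:
  assumes "dim_at_least TYPE('a::real_inner) 2"
  obtains x y :: "'a::real_inner" where "norm x = 1" "norm y = 1" "orthogonal x y"
proof -
  obtain B :: "'a set" where B: "independent B" "infinite B \<or> 2 \<le> card B"
    using assms by (auto simp: dim_at_least_def)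
  then obtain S where S: "S \<subseteq> B" "card S = 2"
    by (meson infinite_arbitrarily_large obtain_subset_with_card_n)
  then obtain u v where uv: "S = {u, v}" "u \<noteq> v"
    by (meson card_2_iff)
  \<comment> \<open>With \<open>v\<close> inserted last, \<open>independent_insert\<close> yields
    that \<open>v\<close> lies outside the span of \<open>u\<close>.\<close>
  then have ind: "independent {v, u}"
    using B(1) S(1) by (metis independent_mono insert_commute)
  then have "u \<noteq> 0" "v \<notin> span {u}"
    using uv(2) by (auto simp: independent_insert dest: dependent_zero)
  \<comment> \<open>The component of \<open>v\<close> orthogonal to \<open>u\<close>; it vanishes
    only if \<open>v\<close> is a multiple of \<open>u\<close>.\<close>
  define w where "w = v - (v \<bullet> u / (u \<bullet> u)) *\<^sub>R u"
  have "w \<noteq> 0"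
    using \<open>v \<notin> span {u}\<close> by (auto simp: w_def span_singleton)
  have "orthogonal u w"
    using \<open>u \<noteq> 0\<close> by (simp add: w_def orthogonal_def inner_diff_right inner_commute)
  show thesis
  proof
    show "norm (sgn u) = 1" "norm (sgn w) = 1"
      using \<open>u \<noteq> 0\<close> \<open>w \<noteq> 0\<close> by (auto simp: norm_sgn)
    show "orthogonal (sgn u) (sgn w)"
      using \<open>orthogonal u w\<close> by (simp add: sgn_div_norm orthogonal_clauses)
  qed
qed

lemma J_B_real_inner:
  assumes "dim_at_least TYPE('a::real_inner) 2"
  shows "J_B TYPE('a) t \<tau> = sqrt (1 + \<tau>\<^sup>2)"
proof -
  have "power_mean t (norm (x + \<tau> *\<^sub>R y)) (norm (x - \<tau> *\<^sub>R y)) = sqrt (1 + \<tau>\<^sup>2)"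
    if "norm x = 1" "norm y = 1" "orthogonal x y" for x y :: 'a
    \<comment> \<open>The coefficients \<tau> and -\<tau> have the same square, so the two norms
      agree.\<close>
    using norm_add_orthonormal[of x y \<tau>] norm_add_orthonormal[of x y "- \<tau>"] that
    by (simp add: power_mean_same add_pos_nonneg)
  \<comment> \<open>A witness makes the set a singleton rather than empty, where \<open>Sup\<close>
    on the reals would carry no information.\<close>
  moreover obtain x y :: 'a where "norm x = 1" "norm y = 1" "orthogonal x y"
    using assms by (rule dim_at_least_2_imp_orthonormal)
  ultimately have "{power_mean t (norm (x + \<tau> *\<^sub>R y)) (norm (x - \<tau> *\<^sub>R y)) | x y :: 'a.
      x \<in> sphere 0 1 \<and> y \<in> sphere 0 1 \<and> x \<bottom>\<^sub>B y} = {sqrt (1 + \<tau>\<^sup>2)}"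
    by (force simp: birkhoff_orthogonal_iff_orthogonal)
  then show ?thesis
    by (simp add: J_B_def)
qed

lemma C_B_real_inner:
  assumes "dim_at_least TYPE('a::real_inner) 2"
  shows "C_B TYPE('a) t = 1"
proof -
  have "(J_B TYPE('a) t \<tau>)\<^sup>2 / (1 + \<tau>\<^sup>2) = 1" for \<tau>
    using J_B_real_inner[OF assms] by (simp add: add_pos_nonneg less_imp_neq[symmetric])
  \<comment> \<open>What remains is the supremum of the constant 1 over the nonempty interval
    \<open>{0..1}\<close>.\<close>
  then show ?thesis
    by (simp only: C_B_def) simp
qed

theorem proposition3:
  assumes "dim_at_least TYPE('h::{real_inner, banach}) 2"
  shows "(\<forall>\<tau>\<ge>0. \<forall>t<\<infinity>. J_B TYPE('h) t \<tau> = sqrt (1 + \<tau>\<^sup>2))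
       \<and> (\<forall>t<\<infinity>. C_B TYPE('h) t = 1)"
  using J_B_real_inner[OF assms] C_B_real_inner[OF assms] by blast

end
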